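(* The Weak Shanks Conjecture is false. That is, the following assertion is false: for every polynomial $f\in\mathbb{C}[z_1,z_2]$ with no zeros in $\overline{\mathbb{D}^2}$ and every $n\in\mathbb{N}$, the optimal polynomial approximant of degree $n$ to $1/f$ in $H^2(\mathbb{D}^2)$ has no zeros in $\mathbb{D}^2$. Equivalently, there exist a polynomial $f\in\mathbb{C}[z_1,z_2]$ with no zeros in $\overline{\mathbb{D}^2}$ and an $n\in\mathbb{N}$ such that the optimal polynomial approximant of degree $n$ to $1/f$ in $H^2(\mathbb{D}^2)$ has a zero in $\mathbb{D}^2$.
   Context: $\mathbb{D}=\{z\in\mathbb{C}:|z|<1\}$, $\mathbb{D}^2=\mathbb{D}\times\mathbb{D}$, and $\overline{\mathbb{D}^2}$ is the closed bidisk. The Hardy space $H^2(\mathbb{D}^2)$ is the Hilbert space of holomorphic functions $g(z_1,z_2)=\sum_{k,l\ge 0}a_{k,l}z_1^kz_2^l$ on $\mathbb{D}^2$ with $\|g\|_{H^2(\mathbb{D}^2)}=\left(\sum_{k,l\ge 0}|a_{k,l}|^2\right)^{1/2}<\infty$. For $n\in\mathbb{N}$, $\mathcal{P}_n$ denotes the space of polynomials in $z_1,z_2$ spanned by the monomials $z_1^kz_2^l$ with $k+l\le n$. For nonzero $f\in H^2(\mathbb{D}^2)$, the optimal polynomial approximant (OPA) of degree $n$ to $1/f$ is the unique $p\in\mathcal{P}_n$ minimizing $\|1-pf\|_{H^2(\mathbb{D}^2)}$ over $\mathcal{P}_n$ (so $pf$ is the orthogonal projection of $1$ onto $\mathcal{P}_nf$).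 *)

theory Defs
  imports "HOL-Complex_Analysis.Complex_Analysis" "HOL-Computational_Algebra.Polynomial"
begin

definition bidisk :: "(complex \<times> complex) set" where
  "bidisk = ball 0 1 \<times> ball 0 1"

definition closed_bidisk :: "(complex \<times> complex) set" where
  "closed_bidisk = cball 0 1 \<times> cball 0 1"

text \<open>
  An element \<open>p\<close> of \<open>\<complex>[z\<^sub>1, z\<^sub>2]\<close> is an element of \<open>\<complex>[z\<^sub>1][z\<^sub>2]\<close>: the coefficient of
  \<open>z\<^sub>1 ^ k * z\<^sub>2 ^ l\<close> is \<open>coeff (coeff p l) k\<close>. Evaluation substitutes \<open>z\<^sub>2\<close> first.
\<close>

type_synonym poly2 = "complex poly poly"

definition eval2 :: "poly2 \<Rightarrow> complex \<times> complex \<Rightarrow> complex" where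
  "eval2 p = (\<lambda>(z1, z2). poly (poly p [:z2:]) z1)"

lemma eval2_altdef:
  "eval2 p (z1, z2) = (\<Sum>l\<le>degree p. \<Sum>k\<le>degree (coeff p l). coeff (coeff p l) k * z1 ^ k * z2 ^ l)"
  by (simp add: eval2_def poly_altdef[of p] poly_sum poly_altdef[of "coeff p _"] sum_distrib_right)

definition polys_upto :: "nat \<Rightarrow> poly2 set" where
  "polys_upto n = {p. \<forall>k l. coeff (coeff p l) k \<noteq> 0 \<longrightarrow> k + l \<le> n}"

text \<open>
  Functions on the bidisk are total functions whose values outside the bidisk are irrelevant.
  A double power series that converges (hence converges absolutely) at each point of the
  bidisk has a holomorphic sum there, so holomorphy need not be required separately.
\<close>

definition has_expansion ::
  "(complex \<times> complex \<Rightarrow> complex) \<Rightarrow> (nat \<times> nat \<Rightarrow> complex) \<Rightarrow> bool" where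
  "has_expansion g a \<longleftrightarrow>
     (\<forall>(z1, z2) \<in> bidisk. ((\<lambda>(k, l). a (k, l) * z1 ^ k * z2 ^ l) has_sum g (z1, z2)) UNIV)"

definition hardy_coeffs :: "(complex \<times> complex \<Rightarrow> complex) \<Rightarrow> nat \<times> nat \<Rightarrow> complex" where
  "hardy_coeffs g = (THE a. has_expansion g a)"

lemma has_expansion_zero:
  assumes "has_expansion (\<lambda>_. 0) c"
  shows "c = (\<lambda>_. 0)"
proof -
  have powser0: "d = (\<lambda>_. 0)"
    if d: "\<And>z. cmod z < 1 \<Longrightarrow> (\<lambda>k. d k * z ^ k) sums 0" for d :: "nat \<Rightarrow> complex"
  proof (rule ccontr)
    assume "d \<noteq> (\<lambda>_. 0)"
    then obtain m where m: "d m \<noteq> 0" by auto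
    have d0: "d 0 = 0"
      using d[of 0] by simp
    have "m > 0" using m d0 by (cases m) auto
    show False
    proof (rule powser_0_nonzero[of 1 0 d "\<lambda>_. 0" m])
      fix s :: real
      assume s: "0 < s" "\<And>z::complex. z \<in> cball 0 s - {0} \<Longrightarrow> (0::complex) \<noteq> 0"
      have "complex_of_real s \<in> cball 0 s - {0}" using s(1) by auto
      from s(2)[OF this] show False by simp
    qed (use d m \<open>m > 0\<close> in auto)
  qed
  have S: "((\<lambda>(k, l). c (k, l) * z1 ^ k * z2 ^ l) has_sum 0) (UNIV \<times> UNIV)"
    if "cmod z1 < 1" "cmod z2 < 1" for z1 z2
    using assms that by (auto simp: has_expansion_def bidisk_def dist_norm)
  have inner: "(\<lambda>l. c (k, l) * z2 ^ l) summable_on UNIV" if z2: "cmod z2 < 1" for k z2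
  proof -
    have "(\<lambda>l. c (k, l) * (1/2) ^ k * z2 ^ l) summable_on UNIV"
      using summable_on_SigmaD1[of "\<lambda>k l. c (k, l) * (1/2) ^ k * z2 ^ l" UNIV "\<lambda>_. UNIV" k]
        S[of "1/2" z2] z2 by (auto dest: has_sum_imp_summable)
    then have "(\<lambda>l. 2 ^ k * (c (k, l) * (1/2) ^ k * z2 ^ l)) summable_on UNIV"
      by (rule summable_on_cmult_right)
    then show ?thesis by (simp add: field_simps)
  qed
  have row: "(\<Sum>\<^sub>\<infinity>l. c (k, l) * z2 ^ l) = 0" if z2: "cmod z2 < 1" for k z2
  proof -
    have "(\<lambda>k. \<Sum>\<^sub>\<infinity>l. c (k, l) * z2 ^ l) = (\<lambda>_. 0)"
    proof (rule powser0)
      fix z1 :: complex assume z1: "cmod z1 < 1"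
      have "((\<lambda>l. (case (k, l) of (k, l) \<Rightarrow> c (k, l) * z1 ^ k * z2 ^ l)) has_sum
              (\<Sum>\<^sub>\<infinity>l. c (k, l) * z2 ^ l) * z1 ^ k) UNIV" for k
        using has_sum_cmult_left[OF has_sum_infsum[OF inner[OF z2, of k]], of "z1 ^ k"]
        by (simp add: mult_ac)
      then have "((\<lambda>k. (\<Sum>\<^sub>\<infinity>l. c (k, l) * z2 ^ l) * z1 ^ k) has_sum 0) UNIV"
        by (rule has_sum_SigmaD[OF S[OF z1 z2]])
      then show "(\<lambda>k. (\<Sum>\<^sub>\<infinity>l. c (k, l) * z2 ^ l) * z1 ^ k) sums 0"
        by (rule has_sum_imp_sums)
    qed
    then show ?thesis by meson
  qed
  have "(\<lambda>l. c (k, l)) = (\<lambda>_. 0)" for k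
  proof (rule powser0)
    fix z :: complex assume z: "cmod z < 1"
    have "((\<lambda>l. c (k, l) * z ^ l) has_sum 0) UNIV"
      using has_sum_infsum[OF inner[OF z, of k]] row[OF z, of k] by simp
    then show "(\<lambda>l. c (k, l) * z ^ l) sums 0" by (rule has_sum_imp_sums)
  qed
  then show ?thesis by (auto simp: fun_eq_iff)
qed

lemma has_expansion_unique:
  assumes "has_expansion g a" "has_expansion g b"
  shows "a = b"
proof -
  have "has_expansion (\<lambda>_. 0) (\<lambda>i. a i - b i)"
    unfolding has_expansion_def
  proof clarify
    fix z1 z2 assume "(z1, z2) \<in> bidisk"
    with assms have
      "((\<lambda>(k, l). a (k, l) * z1 ^ k * z2 ^ l) has_sum g (z1, z2)) UNIV"
      "((\<lambda>(k, l). b (k, l) * z1 ^ k * z2 ^ l) has_sum g (z1, z2)) UNIV"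
      by (auto simp: has_expansion_def)
    from has_sum_add[OF this(1) has_sum_uminusI[OF this(2)]]
    show "((\<lambda>(k, l). (a (k, l) - b (k, l)) * z1 ^ k * z2 ^ l) has_sum 0) UNIV"
      by (simp add: case_prod_unfold algebra_simps)
  qed
  then show ?thesis
    using has_expansion_zero by (fastforce simp: fun_eq_iff)
qed

lemma hardy_coeffs_eq: "has_expansion g a \<Longrightarrow> hardy_coeffs g = a"
  unfolding hardy_coeffs_def using has_expansion_unique by blast

definition hardy_space :: "(complex \<times> complex \<Rightarrow> complex) set" where
  "hardy_space =
     {g. \<exists>a. has_expansion g a \<and> (\<lambda>i. (cmod (a i))\<^sup>2) summable_on UNIV}"

definition hardy_norm :: "(complex \<times> complex \<Rightarrow> complex) \<Rightarrow> real" where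
  "hardy_norm g = sqrt (\<Sum>\<^sub>\<infinity>i. (cmod (hardy_coeffs g i))\<^sup>2)"

text \<open>
  \<open>is_opa f n p\<close>: \<open>p\<close> is the optimal polynomial approximant of degree \<open>n\<close> to \<open>1/f\<close>, where
  \<open>f\<close> is a nonzero element of the Hardy space. (The minimizer is unique, as \<open>p \<mapsto> p f\<close> is
  injective and linear on a finite-dimensional space.)
\<close>

definition is_opa :: "(complex \<times> complex \<Rightarrow> complex) \<Rightarrow> nat \<Rightarrow> poly2 \<Rightarrow> bool" where
  "is_opa f n p \<longleftrightarrow>
     f \<in> hardy_space \<and> (\<exists>z\<in>bidisk. f z \<noteq> 0) \<and>
     is_arg_min (\<lambda>q. hardy_norm (\<lambda>z. 1 - eval2 q z * f z)) (\<lambda>q. q \<in> polys_upto n) p"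

end

theory Submission
  imports Defs
begin

text \<open>
  For \<open>n = 1\<close> and symmetric \<open>f\<close> with real coefficients, put \<open>N = \<parallel>f\<parallel>\<^sup>2\<close>,
  \<open>A = \<langle>f, z\<^sub>1 f\<rangle> = \<langle>f, z\<^sub>2 f\<rangle>\<close> and \<open>G = \<langle>z\<^sub>1 f, z\<^sub>2 f\<rangle>\<close>. The normal equations show that the
  approximant is a multiple of \<open>(N + G) - A (z\<^sub>1 + z\<^sub>2)\<close>, which vanishes on the diagonal at
  \<open>(N + G) / (2 A)\<close>. So it suffices that \<open>2 A > N + G\<close>. With \<open>z\<^sub>j = exp (i \<theta>\<^sub>j)\<close>,
  \<open>s = (\<theta>\<^sub>1 + \<theta>\<^sub>2) / 2\<close> and \<open>d = (\<theta>\<^sub>1 - \<theta>\<^sub>2) / 2\<close>, this says that the integral of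
  \<open>\<bar>f\<bar>\<^sup>2 cos d (cos s - cos d)\<close> over the torus is positive, which favours \<open>f\<close> with \<open>\<bar>f\<bar>\<^sup>2\<close>
  concentrated near \<open>s = 0\<close>, \<open>d = \<plusminus>\<pi>/3\<close>. The zero-free polynomial
  \<open>f = (2 + z\<^sub>1 + z\<^sub>2 + z\<^sub>1 z\<^sub>2)\<^sup>2 (2 + z\<^sub>1 z\<^sub>2)\<close> has \<open>N = 659\<close>, \<open>A = 444\<close> and \<open>G = 212\<close>.
\<close>

lemma eval2_1: "eval2 1 z = 1"
  and eval2_diff: "eval2 (p - q) z = eval2 p z - eval2 q z"
  and eval2_mult: "eval2 (p * q) z = eval2 p z * eval2 q z"
  by (simp_all add: eval2_def split: prod.split)

lemma has_expansion_eval2: "has_expansion (eval2 p) (\<lambda>(k, l). coeff (coeff p l) k)"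
  unfolding has_expansion_def
proof
  fix z :: "complex \<times> complex"
  obtain z1 z2 where z: "z = (z1, z2)" by fastforce
  \<comment> \<open>\<open>eval2_altdef\<close> sums over pairs (l, k), expansions over (k, l);
    hence \<open>prod.swap\<close> below.\<close>
  define D where "D = (SIGMA l:{..degree p}. {..degree (coeff p l)})"
  have fin: "finite D" by (simp add: D_def)
  have "eval2 p (z1, z2) = (\<Sum>(l, k)\<in>D. coeff (coeff p l) k * z1 ^ k * z2 ^ l)"
    unfolding eval2_altdef D_def by (subst sum.Sigma) auto
  also have "\<dots> = (\<Sum>(k, l)\<in>prod.swap ` D. coeff (coeff p l) k * z1 ^ k * z2 ^ l)"
    by (subst sum.reindex) (auto simp: case_prod_unfold intro!: sum.cong)
  finally have "((\<lambda>(k, l). coeff (coeff p l) k * z1 ^ k * z2 ^ l) has_sum eval2 p (z1, z2)) (prod.swap ` D)"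
    using fin by (simp add: has_sum_finite)
  moreover have "coeff (coeff p l) k = 0" if "(k, l) \<notin> prod.swap ` D" for k l
  proof (cases "l \<le> degree p")
    case True
    then have "k > degree (coeff p l)"
      using that by (force simp: D_def image_iff)
    then show ?thesis by (rule coeff_eq_0)
  qed (simp add: coeff_eq_0)
  ultimately have "((\<lambda>(k, l). coeff (coeff p l) k * z1 ^ k * z2 ^ l) has_sum eval2 p (z1, z2)) UNIV"
    by (subst has_sum_cong_neutral[where T = "prod.swap ` D"
          and g = "\<lambda>(k, l). coeff (coeff p l) k * z1 ^ k * z2 ^ l"]) auto
  then show "case z of (z1, z2) \<Rightarrow>
      ((\<lambda>(k, l). (case (k, l) of (k, l) \<Rightarrow> coeff (coeff p l) k) * z1 ^ k * z2 ^ l)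
        has_sum eval2 p (z1, z2)) UNIV"
    by (simp add: z)
qed

lemma finite_coeffs_support: "finite {(k, l). coeff (coeff p l) k \<noteq> (0 :: complex)}"
proof (rule finite_subset)
  show "{(k, l). coeff (coeff p l) k \<noteq> 0} \<subseteq> (\<Union>l\<le>degree p. {..degree (coeff p l)} \<times> {l})"
    by (auto simp: le_degree) (metis coeff_0 le_degree)
qed auto

lemma eval2_in_hardy_space: "eval2 p \<in> hardy_space"
proof -
  have "(\<lambda>(k, l). (cmod (coeff (coeff p l) k))\<^sup>2) summable_on UNIV"
    by (subst summable_on_cong_neutral[where T = "{(k, l). coeff (coeff p l) k \<noteq> 0}"
          and g = "\<lambda>(k, l). (cmod (coeff (coeff p l) k))\<^sup>2"])
      (auto intro!: summable_on_finite simp: finite_coeffs_support)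
  then show ?thesis
    unfolding hardy_space_def using has_expansion_eval2[of p]
    by (auto simp: case_prod_unfold)
qed

lemma hardy_norm_eval2:
  assumes "\<And>k l. coeff (coeff p l) k \<noteq> 0 \<Longrightarrow> k < m \<and> l < m"
  shows "hardy_norm (eval2 p) = sqrt (\<Sum>l<m. \<Sum>k<m. (cmod (coeff (coeff p l) k))\<^sup>2)"
proof -
  have "(\<Sum>\<^sub>\<infinity>(k, l). (cmod (coeff (coeff p l) k))\<^sup>2)
      = (\<Sum>\<^sub>\<infinity>(k, l)\<in>{..<m} \<times> {..<m}. (cmod (coeff (coeff p l) k))\<^sup>2)"
    using assms by (intro infsum_cong_neutral) auto
  also have "\<dots> = (\<Sum>k<m. \<Sum>l<m. (cmod (coeff (coeff p l) k))\<^sup>2)"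
    by (simp add: sum.cartesian_product)
  finally show ?thesis
    unfolding hardy_norm_def hardy_coeffs_eq[OF has_expansion_eval2]
    by (subst sum.swap) (simp add: case_prod_unfold)
qed

lemma polys_upto_1_cases:
  assumes "q \<in> polys_upto 1"
  obtains a b c where "q = [:[:a, b:], [:c:]:]"
proof -
  have "coeff (coeff q l) k = 0" if "k + l > 1" for k l
    using assms that by (force simp: polys_upto_def)
  then have "q = [:[:coeff (coeff q 0) 0, coeff (coeff q 0) 1:], [:coeff (coeff q 1) 0:]:]"
    by (auto simp: poly_eq_iff coeff_pCons split: nat.split)
  then show thesis by (rule that)
qed

definition f0 :: poly2 where
  "f0 = [:[:2, 1:], [:1, 1:]:]\<^sup>2 * [:[:2:], [:0, 1:]:]"

lemma f0_altdef:
  "f0 = [:[:8, 8, 2:], [:8, 16, 8, 1:], [:2, 8, 8, 2:], [:0, 1, 2, 1:]:]"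
  by (simp add: f0_def power2_eq_square)

lemma f0_nonzero:
  assumes "z \<in> closed_bidisk"
  shows "eval2 f0 z \<noteq> 0"
proof -
  obtain z1 z2 where z: "z = (z1, z2)" "cmod z1 \<le> 1" "cmod z2 \<le> 1"
    using assms by (auto simp: closed_bidisk_def)
  have "cmod (z1 * z2) \<le> 1"
    using z by (simp add: norm_mult mult_le_one)
  then have "2 + z1 * z2 \<noteq> 0"
    by (auto simp: add_eq_0_iff)
  \<comment> \<open>This is the squared factor of \<open>f0\<close>. A zero forces |2 + z1| \<le> |1
    + z1|, so z1 lies in a half-plane missing the closed disk.\<close>
  moreover have "(2 + z1) + z2 * (1 + z1) \<noteq> 0"
  proof
    assume "(2 + z1) + z2 * (1 + z1) = 0"
    then have "2 + z1 = - (z2 * (1 + z1))"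
      by (simp add: add_eq_0_iff2)
    then have "cmod (2 + z1) = cmod z2 * cmod (1 + z1)"
      by (simp add: norm_mult)
    also have "\<dots> \<le> cmod (1 + z1)"
      using z by (simp add: mult_left_le_one_le)
    finally have "(cmod (2 + z1))\<^sup>2 \<le> (cmod (1 + z1))\<^sup>2"
      by simp
    then have "Re z1 \<le> - 3 / 2"
      unfolding cmod_power2 by (simp add: power2_eq_square algebra_simps)
    moreover have "\<bar>Re z1\<bar> \<le> 1"
      using abs_Re_le_cmod[of z1] z by simp
    ultimately show False by simp
  qed
  moreover have "eval2 f0 z = ((2 + z1) + z2 * (1 + z1))\<^sup>2 * (2 + z1 * z2)"
    by (simp add: z f0_def eval2_def algebra_simps)
  ultimately show ?thesis by simp
qed

text \<open>The squared norm of (a + b z1 + c z2) f0 for real a, b, c: the coefficients are N, 2A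
  and 2G.\<close>

definition gram_form :: "real \<Rightarrow> real \<Rightarrow> real \<Rightarrow> real" where
  "gram_form a b c = 659 * (a\<^sup>2 + b\<^sup>2 + c\<^sup>2) + 888 * a * (b + c) + 424 * b * c"

lemma gram_form_nonneg: "gram_form a b c \<ge> 0"
proof -
  \<comment> \<open>Complete the square in a, then diagonalise in b - c and b + c.\<close>
  have "gram_form a b c =
      659 * (a + 444 / 659 * (b + c))\<^sup>2 + 447 / 2 * (b - c)\<^sup>2
        + (871 / 2 - 444\<^sup>2 / 659) * (b + c)\<^sup>2"
    by (simp add: gram_form_def power2_eq_square field_simps)
  then show ?thesis by simp
qed

text \<open>The linear term is -2 Re (a f0(0, 0)) with f0(0, 0) = 8. Real and imaginary parts
  separate because \<open>f0\<close> has real coefficients.\<close>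

lemma hardy_norm_residual:
  "hardy_norm (\<lambda>z. 1 - eval2 [:[:a, b:], [:c:]:] z * eval2 f0 z) =
     sqrt (gram_form (Re a) (Re b) (Re c) + gram_form (Im a) (Im b) (Im c) - 16 * Re a + 1)"
proof -
  define r where "r = 1 - [:[:a, b:], [:c:]:] * f0"
  have r: "r =
    [:[:1 - 8 * a, - (8 * a + 8 * b), - (2 * a + 8 * b), - (2 * b):],
      [:- (8 * a + 8 * c), - (16 * a + 8 * b + 8 * c), - (8 * a + 16 * b + 2 * c), - (a + 8 * b), - b:],
      [:- (2 * a + 8 * c), - (8 * a + 2 * b + 16 * c), - (8 * a + 8 * b + 8 * c), - (2 * a + 8 * b + c), - (2 * b):],
      [:- (2 * c), - (a + 8 * c), - (2 * a + b + 8 * c), - (a + 2 * b + 2 * c), - b:],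
      [:0, - c, - (2 * c), - c:]:]"
    by (simp add: r_def f0_altdef one_pCons algebra_simps)
  have "hardy_norm (\<lambda>z. eval2 r z) = sqrt (\<Sum>l<5. \<Sum>k<5. (cmod (coeff (coeff r l) k))\<^sup>2)"
    by (rule hardy_norm_eval2)
      (auto simp: r coeff_pCons numeral_eq_Suc split: nat.splits)
  also have "(\<Sum>l<5. \<Sum>k<5. (cmod (coeff (coeff r l) k))\<^sup>2) =
      gram_form (Re a) (Re b) (Re c) + gram_form (Im a) (Im b) (Im c) - 16 * Re a + 1"
    unfolding cmod_power2 unfolding gram_form_def power2_eq_square
    by (simp add: r eval_nat_numeral) (simp add: algebra_simps)
  finally show ?thesis
    by (simp only: r_def eval2_diff eval2_1 eval2_mult)
qed

text \<open>With b = c the normal equations read 659 a + 888 b = 8 and 444 a + 871 b = 0, of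
  determinant 179717.\<close>

definition p0 :: poly2 where
  "p0 = [:[:6968 / 179717, - (3552 / 179717):], [:- (3552 / 179717):]:]"

lemma is_opa_p0: "is_opa (eval2 f0) 1 p0"
  unfolding is_opa_def
proof (intro conjI)
  show "eval2 f0 \<in> hardy_space"
    by (rule eval2_in_hardy_space)
  show "\<exists>z\<in>bidisk. eval2 f0 z \<noteq> 0"
    by (rule bexI[of _ "(0, 0)"]) (auto intro!: f0_nonzero simp: bidisk_def closed_bidisk_def)
  have "p0 \<in> polys_upto 1"
    by (auto simp: polys_upto_def p0_def coeff_pCons split: nat.splits)
  moreover have "hardy_norm (\<lambda>z. 1 - eval2 p0 z * eval2 f0 z)
      \<le> hardy_norm (\<lambda>z. 1 - eval2 q z * eval2 f0 z)" if q_in: "q \<in> polys_upto 1" for q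
  proof -
    obtain a b c where q: "q = [:[:a, b:], [:c:]:]"
      using q_in by (rule polys_upto_1_cases)
    let ?u = "Re a - 6968 / 179717" and ?v = "Re b + 3552 / 179717" and ?w = "Re c + 3552 / 179717"
    \<comment> \<open>Expanding around \<open>p0\<close>, the linear terms cancel by the normal
      equations.\<close>
    have "gram_form (Re a) (Re b) (Re c) - 16 * Re a =
        gram_form (6968 / 179717) (- (3552 / 179717)) (- (3552 / 179717)) - 16 * (6968 / 179717)
          + gram_form ?u ?v ?w"
      by (simp add: gram_form_def power2_eq_square field_simps)
    then show ?thesis
      unfolding q p0_def hardy_norm_residual
      using gram_form_nonneg[of ?u ?v ?w] gram_form_nonneg[of "Im a" "Im b" "Im c"]
      by (simp add: gram_form_def)
  qed
  ultimately show "is_arg_min (\<lambda>q. hardy_norm (\<lambda>z. 1 - eval2 q z * eval2 f0 z))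
      (\<lambda>q. q \<in> polys_upto 1) p0"
    by (simp add: is_arg_min_linorder)
qed

theorem corollary2p2:
  shows "\<not> (\<forall>f :: poly2. (\<forall>z\<in>closed_bidisk. eval2 f z \<noteq> 0) \<longrightarrow>
            (\<forall>n p. is_opa (eval2 f) n p \<longrightarrow> (\<forall>z\<in>bidisk. eval2 p z \<noteq> 0)))"
proof -
  \<comment> \<open>The diagonal zero (N + G) / (2 A).\<close>
  have "eval2 p0 (871 / 888, 871 / 888) = 0"
    by (simp add: eval2_def p0_def)
  moreover have "(871 / 888, 871 / 888) \<in> bidisk"
    by (simp add: bidisk_def norm_divide)
  ultimately show ?thesis
    using f0_nonzero is_opa_p0 by blast
qed

end
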